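(* Let $\langle\cdot,\cdot\rangle$ be an inner product on $\mathbb{R}^d$ with induced norm $\|\cdot\|$, let $\mathbf{c}\in\mathbb{R}^d$, and let $\emptyset\neq\mathcal{P}\subset\mathbb{R}^d$ be a polytope with set of extreme points $\exp(\mathcal{P})$. Let $\mathcal{M}=\arg\min_{\mathbf{x}\in\mathcal{P}}\langle\mathbf{c},\mathbf{x}\rangle$, and assume that the projection of the origin onto $\mathcal{P}$ does not belong to $\mathcal{M}$. For $\eta>0$ let $\mathbf{x}^\eta$ be the unique minimizer of $\langle\mathbf{c},\mathbf{x}\rangle+\frac{\|\mathbf{x}\|^2}{\eta}$ over $\mathbf{x}\in\mathcal{P}$, let $\mathbf{x}^0=\arg\min_{\mathbf{x}\in\mathcal{P}}\|\mathbf{x}\|^2$, and let $\mathbf{x}^*=\arg\min_{\mathbf{x}\in\mathcal{M}}\|\mathbf{x}\|^2$ be the minimizer of the linear program $\min_{\mathbf{x}\in\mathcal{P}}\langle\mathbf{c},\mathbf{x}\rangle$ with minimal norm. Let $0=\eta_0<\eta_1<\dots<\eta_n=\eta^*$ be the breakpoints of the piecewise affine curve $\eta\mapsto\mathbf{x}^\eta$ (see context); in particular, $\eta^*$ is the (smallest) threshold such that $\mathbf{x}^\eta=\mathbf{x}^*$ for all $\eta\ge\eta^*$. Let $\mathcal{E}(\eta)=\langle\mathbf{c},\mathbf{x}^\eta\rangle-\min_{\mathbf{x}\in\mathcal{P}}\langle\mathbf{c},\mathbf{x}\rangle$. Then: (a) The threshold $\eta^*$ is given by $$\eta^*=2\max_{\mathbf{x}\in\exp(\mathcal{P})\setminus\mathcal{M}}\frac{\langle\mathbf{x}^*,\mathbf{x}^*-\mathbf{x}\rangle}{\langle\mathbf{c},\mathbf{x}-\mathbf{x}^*\rangle}.$$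 The right-hand side attains its maximum on the set $\mathcal{M}(\mathcal{P},\mathbf{c}^* ):=\arg\min_{\mathbf{x}\in\mathcal{P}}\langle\mathbf{c}^*,\mathbf{x}\rangle$ of minimizers for the linear program over $\mathcal{P}$ with the auxiliary cost $\mathbf{c}^*:=\frac{\eta^*\mathbf{c}}{2}+\mathbf{x}^*$. Moreover, $\mathbf{x}^\eta\in\mathcal{M}(\mathcal{P},\mathbf{c}^* )$ for all $\eta\in[\eta_{n-1},\eta^*]$, so that $$\eta^*=2\,\frac{\langle\mathbf{x}^*,\mathbf{x}^*-\mathbf{x}^\eta\rangle}{\langle\mathbf{c},\mathbf{x}^\eta-\mathbf{x}^*\rangle}\quad\text{for all }\eta\in[\eta_{n-1},\eta^* ).$$ (b) The slope $\frac{\mathcal{E}(\eta)}{\eta^*-\eta}$ of the last segment of the curve $\eta\mapsto\mathcal{E}(\eta)$ satisfies the bound $$\frac{\mathcal{E}(\eta)}{\eta^*-\eta}\le\frac12\left\langle\mathbf{c},\frac{\mathbf{x}^*-\mathbf{x}^{\eta_{n-1}}}{\|\mathbf{x}^*-\mathbf{x}^{\eta_{n-1}}\|}\right\rangle^2\le\frac{\|\mathbf{c}\|^2}{2},\qquad\eta\in[\eta_{n-1},\eta^* ).$$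
   Context: A polytope is the convex hull of finitely many points in $\mathbb{R}^d$; $\exp(\mathcal{P})$ denotes its (finite) set of extreme points (vertices). Projections are with respect to the norm $\|\cdot\|$. Breakpoints: it is known that the curve $[0,\infty)\ni\eta\mapsto\mathbf{x}^\eta$ is piecewise affine and converges stationarily to $\mathbf{x}^*$ as $\eta\to\infty$. That is, there exist $n\in\mathbb{N}$, $n\ge1$, and $0=\eta_0<\eta_1<\dots<\eta_n=:\eta^*$ such that $[\eta_i,\eta_{i+1}]\ni\eta\mapsto\mathbf{x}^\eta$ is affine for every $i\in\{0,\dots,n-1\}$, and $\mathbf{x}^\eta=\mathbf{x}^*$ for all $\eta\ge\eta^*$, where $\eta^*$ is the smallest number with the latter property. These $\eta_i$ are called the breakpoints. *)

theory Defs
  imports "HOL-Analysis.Analysis"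
begin

(* The inner product is arbitrary: it is a parameter ip and in general not the
   library's inner product on the type.  Norms below are the ones induced by ip. *)

definition is_inner_product :: "('a::real_vector \<Rightarrow> 'a \<Rightarrow> real) \<Rightarrow> bool" where
  "is_inner_product ip \<longleftrightarrow>
     bilinear ip \<and> (\<forall>x y. ip x y = ip y x) \<and> (\<forall>x. x \<noteq> 0 \<longrightarrow> 0 < ip x x)"

definition ip_norm :: "('a::real_vector \<Rightarrow> 'a \<Rightarrow> real) \<Rightarrow> 'a \<Rightarrow> real" where
  "ip_norm ip x = sqrt (ip x x)"

definition argmin_set :: "('a \<Rightarrow> real) \<Rightarrow> 'a set \<Rightarrow> 'a set" where
  "argmin_set f S = {x. is_arg_min f (\<lambda>x. x \<in> S) x}"

definition argmax_set :: "('a \<Rightarrow> real) \<Rightarrow> 'a set \<Rightarrow> 'a set" where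
  "argmax_set f S = {x. is_arg_max f (\<lambda>x. x \<in> S) x}"

(* Only meaningful when the minimizer exists and is unique.  This is the case in all uses
   below: strictly convex continuous functions on nonempty compact convex sets. *)
definition the_argmin :: "('a \<Rightarrow> real) \<Rightarrow> 'a set \<Rightarrow> 'a" where
  "the_argmin f S = (THE x. x \<in> argmin_set f S)"

definition projection ::
    "('a::real_vector \<Rightarrow> 'a \<Rightarrow> real) \<Rightarrow> 'a set \<Rightarrow> 'a \<Rightarrow> 'a" where
  "projection ip S z = the_argmin (\<lambda>x. ip_norm ip (x - z)) S"

(* The curve is only meant for t \<ge> 0; values at negative t are junk. *)
definition regularized_curve ::
    "('a::real_vector \<Rightarrow> 'a \<Rightarrow> real) \<Rightarrow> 'a \<Rightarrow> 'a set \<Rightarrow> real \<Rightarrow> 'a" where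
  "regularized_curve ip c P t =
     (if t = 0 then the_argmin (\<lambda>x. (ip_norm ip x)\<^sup>2) P
      else the_argmin (\<lambda>x. ip c x + (ip_norm ip x)\<^sup>2 / t) P)"

definition affine_map_on :: "real set \<Rightarrow> (real \<Rightarrow> 'a::real_vector) \<Rightarrow> bool" where
  "affine_map_on S f \<longleftrightarrow> (\<exists>u v. \<forall>t\<in>S. f t = u + t *\<^sub>R v)"

(* The points \<eta> 0 < ... < \<eta> n; values of \<eta> beyond index n are irrelevant.
   The last clause says that \<eta> n is the smallest threshold in [0, \<infinity>) after which
   x is constantly xs.  Inner points are not required to be genuine kinks of x. *)
definition is_breakpoints ::
    "(real \<Rightarrow> 'a::real_vector) \<Rightarrow> 'a \<Rightarrow> nat \<Rightarrow> (nat \<Rightarrow> real) \<Rightarrow> bool" where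
  "is_breakpoints x xs n \<eta> \<longleftrightarrow>
     1 \<le> n \<and> \<eta> 0 = 0 \<and>
     (\<forall>i<n. \<eta> i < \<eta> (Suc i)) \<and>
     (\<forall>i<n. affine_map_on {\<eta> i..\<eta> (Suc i)} x) \<and>
     (\<forall>t\<ge>\<eta> n. x t = xs) \<and>
     (\<forall>s\<ge>0. (\<forall>t\<ge>s. x t = xs) \<longrightarrow> \<eta> n \<le> s)"

end

theory Submission
  imports Defs
begin

text \<open>
  For every \<open>t \<ge> 0\<close> the point \<open>x t\<close> is characterised by the variational inequality
  \<open>ip ((t/2) c + x t) (y - x t) \<ge> 0\<close> on \<open>P\<close>. Testing this inequality for \<open>x t = xstar\<close> at
  the vertices outside \<open>M\<close> shows that \<open>x t = xstar\<close> holds iff \<open>t/2\<close> dominates all the ratios, which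
  gives the formula for the threshold. On the last segment write
  \<open>x t = xstar + (\<eta>star - t) w\<close>. The variational inequality of \<open>x t\<close> tested at \<open>xstar\<close> yields
  \<open>ip cstar w + (\<eta>star - t) (ip w w - ip c w / 2) \<le> 0\<close>, while that of \<open>xstar\<close> at \<open>\<eta>star\<close>
  yields \<open>ip cstar w \<ge> 0\<close>. Hence \<open>ip cstar w = 0\<close> and \<open>2 (ip w w) \<le> ip c w\<close>; the former is
  the optimality of the segment for the auxiliary cost, the latter the bound on the slope.
\<close>

text \<open>Let \<open>s\<close> tend to 0 from the right. This extracts first-order conditions,
  both for a minimizer along a segment and at the end of the last segment of the curve.\<close>

lemma nonneg_if_affine_nonneg_near_0:
  fixes A B d :: real
  assumes "d > 0" and le: "\<And>s. 0 < s \<Longrightarrow> s \<le> d \<Longrightarrow> 0 \<le> A + s * B"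
  shows "0 \<le> A"
proof (rule tendsto_lowerbound)
  show "((\<lambda>s. A + s * B) \<longlongrightarrow> A) (at_right 0)"
    by (auto intro!: tendsto_eq_intros)
  show "\<forall>\<^sub>F s in at_right 0. 0 \<le> A + s * B"
    using \<open>d > 0\<close> le by (auto simp: eventually_at_right intro!: exI[of _ d])
qed simp

section \<open>Variational inequalities for an arbitrary inner product\<close>

locale inner_product_form =
  fixes ip :: "'a::euclidean_space \<Rightarrow> 'a \<Rightarrow> real"
  assumes is_ip: "is_inner_product ip"
begin

lemma bilinear: "bilinear ip"
  and commute: "ip x y = ip y x"
  and pos: "x \<noteq> 0 \<Longrightarrow> 0 < ip x x"
  using is_ip by (auto simp: is_inner_product_def)

lemmas ip_simps = bilinear_ladd[OF bilinear] bilinear_radd[OF bilinear]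
  bilinear_lsub[OF bilinear] bilinear_rsub[OF bilinear]
  bilinear_lmul[OF bilinear] bilinear_rmul[OF bilinear]
  bilinear_lneg[OF bilinear] bilinear_rneg[OF bilinear]
  bilinear_lzero[OF bilinear] bilinear_rzero[OF bilinear]

lemma ip_ge_0: "0 \<le> ip x x"
  using pos[of x] ip_simps by (cases "x = 0") auto

lemma ip_norm_power2: "(ip_norm ip x)\<^sup>2 = ip x x"
  by (simp add: ip_norm_def ip_ge_0)

lemma ip_continuous_on [continuous_intros]:
  "continuous_on S f \<Longrightarrow> continuous_on S g \<Longrightarrow> continuous_on S (\<lambda>x. ip (f x) (g x))"
  using bilinear by (simp add: bilinear_conv_bounded_bilinear bounded_bilinear.continuous_on)

lemma Cauchy_Schwarz: "(ip x y)\<^sup>2 \<le> ip x x * ip y y"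
proof (cases "y = 0")
  case False
  \<comment> \<open>\<open>?z\<close> is the component of \<open>x\<close> orthogonal to
    \<open>y\<close>, scaled by \<open>ip y y\<close> to avoid division. Its square is
    \<open>ip y y\<close> times the Gram determinant of \<open>x\<close> and
    \<open>y\<close>.\<close>
  let ?z = "ip y y *\<^sub>R x - ip x y *\<^sub>R y"
  have "ip ?z ?z = ip y y * (ip x x * ip y y - (ip x y)\<^sup>2)"
    using commute[of x y] by (simp add: ip_simps algebra_simps power2_eq_square)
  then show ?thesis
    using ip_ge_0[of ?z] pos[OF False] by (simp add: zero_le_mult_iff)
qed (simp add: ip_simps)

text \<open>The expansion \<open>diff\<close> around \<open>x\<close> is exact: a gradient term plus
  a nonnegative quadratic remainder. So the inequality suffices. It is necessary because moving from
  \<open>x\<close> towards \<open>y\<close> by a fraction \<open>s\<close> and dividing by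
  \<open>s\<close> makes the remainder vanish as \<open>s\<close> tends to 0.\<close>

lemma argmin_quadratic_iff:
  assumes "convex S" "k > 0"
  shows "x \<in> argmin_set (\<lambda>y. ip a y + k * ip y y) S \<longleftrightarrow>
    x \<in> S \<and> (\<forall>y\<in>S. 0 \<le> ip (a + (2 * k) *\<^sub>R x) (y - x))"
    (is "x \<in> argmin_set ?f S \<longleftrightarrow> _")
proof -
  have diff: "?f y - ?f x = ip (a + (2 * k) *\<^sub>R x) (y - x) + k * ip (y - x) (y - x)" for y
    using commute[of x y] by (simp add: ip_simps algebra_simps)
  show ?thesis
  proof (intro iffI conjI ballI)
    assume *: "x \<in> argmin_set ?f S"
    then show "x \<in> S" by (simp add: argmin_set_def is_arg_min_def)
    fix y assume "y \<in> S"
    show "0 \<le> ip (a + (2 * k) *\<^sub>R x) (y - x)"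
    proof (rule nonneg_if_affine_nonneg_near_0[of 1 _ "k * ip (y - x) (y - x)"])
      fix s :: real assume s: "0 < s" "s \<le> 1"
      have eq: "x + s *\<^sub>R (y - x) = (1 - s) *\<^sub>R x + s *\<^sub>R y" by (simp add: algebra_simps)
      have "x + s *\<^sub>R (y - x) \<in> S"
        unfolding eq using \<open>convex S\<close> \<open>x \<in> S\<close> \<open>y \<in> S\<close> s by (simp add: convex_alt)
      then have "?f x \<le> ?f (x + s *\<^sub>R (y - x))"
        using * by (auto simp: argmin_set_def is_arg_min_linorder)
      then have "0 \<le> s * (ip (a + (2 * k) *\<^sub>R x) (y - x) + s * (k * ip (y - x) (y - x)))"
        using diff[of "x + s *\<^sub>R (y - x)"]
        by (simp add: bilinear_lmul[OF bilinear] bilinear_rmul[OF bilinear] distrib_left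
            mult.left_commute)
      then show "0 \<le> ip (a + (2 * k) *\<^sub>R x) (y - x) + s * (k * ip (y - x) (y - x))"
        using s by (simp add: zero_le_mult_iff)
    qed simp
  next
    assume *: "x \<in> S \<and> (\<forall>y\<in>S. 0 \<le> ip (a + (2 * k) *\<^sub>R x) (y - x))"
    have "?f x \<le> ?f y" if "y \<in> S" for y
    proof -
      have "0 \<le> ip (a + (2 * k) *\<^sub>R x) (y - x)" using * that by blast
      moreover have "0 \<le> k * ip (y - x) (y - x)" using \<open>k > 0\<close> ip_ge_0 by simp
      ultimately show ?thesis using diff[of y] by linarith
    qed
    with * show "x \<in> argmin_set ?f S"
      by (auto simp: argmin_set_def is_arg_min_linorder)
  qed
qed

text \<open>Testing each inequality at the other point and adding cancels \<open>a\<close> and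
  leaves \<open>k * ip (x - y) (x - y) \<le> 0\<close>.\<close>

lemma variational_inequality_unique:
  assumes "k > 0" "x \<in> S" "y \<in> S"
    and "\<forall>z\<in>S. 0 \<le> ip (a + k *\<^sub>R x) (z - x)" "\<forall>z\<in>S. 0 \<le> ip (a + k *\<^sub>R y) (z - y)"
  shows "x = y"
proof (rule ccontr)
  assume "x \<noteq> y"
  then have "0 < k * ip (x - y) (x - y)" using pos[of "x - y"] \<open>k > 0\<close> by simp
  also have "\<dots> = - (ip (a + k *\<^sub>R x) (y - x) + ip (a + k *\<^sub>R y) (x - y))"
    by (simp add: ip_simps algebra_simps)
  also have "\<dots> \<le> 0"
    using assms(4)[rule_format, OF \<open>y \<in> S\<close>] assms(5)[rule_format, OF \<open>x \<in> S\<close>] by linarith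
  finally show False by simp
qed

text \<open>Compactness gives existence and the previous lemma uniqueness, so the description
  operator in \<open>the_argmin\<close> really picks the minimizer.\<close>

lemma the_argmin_quadratic_iff:
  assumes "convex S" "compact S" "S \<noteq> {}" "k > 0"
  shows "the_argmin (\<lambda>y. ip a y + k * ip y y) S = z \<longleftrightarrow>
    z \<in> S \<and> (\<forall>y\<in>S. 0 \<le> ip (a + (2 * k) *\<^sub>R z) (y - z))"
    (is "the_argmin ?f S = z \<longleftrightarrow> ?VI z")
proof -
  have "continuous_on S ?f" by (intro continuous_intros)
  then obtain x where "x \<in> S" "\<forall>y\<in>S. ?f x \<le> ?f y"
    using continuous_attains_inf assms by blast
  then have "x \<in> argmin_set ?f S" by (auto simp: argmin_set_def is_arg_min_linorder)
  then have x: "?VI x" using assms by (simp add: argmin_quadratic_iff)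
  have unique: "y = x" if "?VI y" for y
    using variational_inequality_unique[of "2 * k" y S x a] x that \<open>k > 0\<close> by simp
  have "the_argmin ?f S = x"
    unfolding the_argmin_def argmin_quadratic_iff[OF assms(1,4)]
    using x unique by (rule the_equality)
  then show ?thesis using x unique by metis
qed

lemma the_argmin_norm_iff:
  assumes "convex S" "compact S" "S \<noteq> {}"
  shows "the_argmin (\<lambda>y. (ip_norm ip y)\<^sup>2) S = z \<longleftrightarrow> z \<in> S \<and> (\<forall>y\<in>S. 0 \<le> ip z (y - z))"
  using the_argmin_quadratic_iff[OF assms, of 1 0 z] by (simp add: ip_norm_power2 ip_simps)

lemma projection_0_eq: "projection ip S 0 = the_argmin (\<lambda>y. (ip_norm ip y)\<^sup>2) S"
  by (simp add: projection_def the_argmin_def argmin_set_def is_arg_min_def ip_norm_def ip_ge_0)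

text \<open>Scaling the gradient \<open>c + (2 / t) *\<^sub>R z\<close> by \<open>t / 2\<close>
  removes the singularity at \<open>t = 0\<close>, so that one condition, affine in
  \<open>t\<close>, also covers the minimal norm point.\<close>

lemma regularized_curve_iff:
  assumes "convex P" "compact P" "P \<noteq> {}" "t \<ge> 0"
  shows "regularized_curve ip c P t = z \<longleftrightarrow>
    z \<in> P \<and> (\<forall>y\<in>P. 0 \<le> ip ((t / 2) *\<^sub>R c + z) (y - z))"
proof (cases "t = 0")
  case True
  then show ?thesis
    using the_argmin_norm_iff[OF assms(1-3)] by (simp add: regularized_curve_def)
next
  case False
  then have "t > 0" using \<open>t \<ge> 0\<close> by simp
  have "(t / 2) *\<^sub>R (c + (2 * (1 / t)) *\<^sub>R z) = (t / 2) *\<^sub>R c + z"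
    using False by (simp add: algebra_simps)
  then have "ip ((t / 2) *\<^sub>R c + z) y = t / 2 * ip (c + (2 * (1 / t)) *\<^sub>R z) y" for y
    by (metis bilinear_lmul[OF bilinear] real_scaleR_def)
  moreover have "0 \<le> t / 2 * r \<longleftrightarrow> 0 \<le> r" for r
    using \<open>t > 0\<close> by (simp add: zero_le_mult_iff)
  ultimately have "0 \<le> ip ((t / 2) *\<^sub>R c + z) y \<longleftrightarrow> 0 \<le> ip (c + (2 * (1 / t)) *\<^sub>R z) y" for y
    by (simp only:)
  then show ?thesis
    using the_argmin_quadratic_iff[OF assms(1-3), of "1 / t" c z] \<open>t > 0\<close>
    by (simp add: regularized_curve_def ip_norm_power2)
qed

text \<open>Exhibits the solution set as a slice of \<open>P\<close> by a hyperplane. Its convexity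
  and compactness follow from this form.\<close>

lemma argmin_linear_eq:
  assumes "z \<in> argmin_set (ip a) P"
  shows "argmin_set (ip a) P = {y \<in> P. ip a (y - z) = 0}"
  using assms by (force simp: argmin_set_def is_arg_min_linorder ip_simps)

lemma argmin_linear_convex_compact:
  assumes "convex P" "compact P" "P \<noteq> {}"
  shows "convex (argmin_set (ip a) P) \<and> compact (argmin_set (ip a) P) \<and> argmin_set (ip a) P \<noteq> {}"
proof -
  have "continuous_on P (ip a)" by (intro continuous_intros)
  then obtain z where "z \<in> P" "\<forall>y\<in>P. ip a z \<le> ip a y"
    using continuous_attains_inf assms by blast
  then have z: "z \<in> argmin_set (ip a) P" by (auto simp: argmin_set_def is_arg_min_linorder)
  have eq: "argmin_set (ip a) P = P \<inter> {y. ip a (y - z) = 0}"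
    using argmin_linear_eq[OF z] by auto
  have "convex {y. ip a (y - z) = 0}"
  proof (rule convexI)
    fix x y and u v :: real
    assume uv: "u + v = 1" and xy: "x \<in> {y. ip a (y - z) = 0}" "y \<in> {y. ip a (y - z) = 0}"
    have "ip a (u *\<^sub>R x + v *\<^sub>R y - z) = u * ip a x + v * ip a y - (u + v) * ip a z"
      using uv by (simp add: ip_simps)
    also have "\<dots> = 0" using xy by (simp add: ip_simps algebra_simps)
    finally show "u *\<^sub>R x + v *\<^sub>R y \<in> {y. ip a (y - z) = 0}" by simp
  qed
  moreover have "closed {y. ip a (y - z) = 0}"
    by (intro closed_Collect_eq continuous_intros)
  ultimately show ?thesis
    using z assms unfolding eq by (auto intro: convex_Int compact_Int_closed)
qed

text \<open>Half-spaces are convex, so linear inequalities over a polytope need only be tested at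
  its vertices.\<close>

lemma nonneg_on_convex_hull:
  assumes "\<And>v. v \<in> V \<Longrightarrow> 0 \<le> ip a (v - z)" "y \<in> convex hull V"
  shows "0 \<le> ip a (y - z)"
proof -
  have "convex {y. 0 \<le> ip a (y - z)}"
  proof (rule convexI)
    fix x y and u v :: real
    assume uv: "0 \<le> u" "0 \<le> v" "u + v = 1"
      and xy: "x \<in> {y. 0 \<le> ip a (y - z)}" "y \<in> {y. 0 \<le> ip a (y - z)}"
    have "0 \<le> u * ip a (x - z) + v * ip a (y - z)" using uv xy by simp
    also have "\<dots> = u * ip a x + v * ip a y - (u + v) * ip a z"
      by (simp add: ip_simps algebra_simps)
    also have "\<dots> = ip a (u *\<^sub>R x + v *\<^sub>R y - z)" using uv by (simp add: ip_simps)
    finally show "u *\<^sub>R x + v *\<^sub>R y \<in> {y. 0 \<le> ip a (y - z)}" by simp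
  qed
  then have "convex hull V \<subseteq> {y. 0 \<le> ip a (y - z)}"
    using assms(1) by (intro hull_minimal) auto
  with assms(2) show ?thesis by blast
qed

end

theorem theorem2p5:
  fixes ip :: "real ^ 'd \<Rightarrow> real ^ 'd \<Rightarrow> real"
    and c xstar cstar :: "real ^ 'd"
    and P M V :: "(real ^ 'd) set"
    and x :: "real \<Rightarrow> real ^ 'd"
    and n :: nat
    and \<eta> :: "nat \<Rightarrow> real"
    and \<eta>star :: real
    and E :: "real \<Rightarrow> real"
    and ratio :: "real ^ 'd \<Rightarrow> real"
  assumes ip: "is_inner_product ip"
    and P: "polytope P" "P \<noteq> {}"
    and V: "V = {v. v extreme_point_of P}"
    and M: "M = argmin_set (\<lambda>y. ip c y) P"
    and proj: "projection ip P 0 \<notin> M"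
    and x: "x = regularized_curve ip c P"
    and xstar: "xstar = the_argmin (\<lambda>y. (ip_norm ip y)\<^sup>2) M"
    and breakpoints: "is_breakpoints x xstar n \<eta>"
    and \<eta>star: "\<eta>star = \<eta> n"
    and E: "E = (\<lambda>t. ip c (x t) - (INF y\<in>P. ip c y))"
    and ratio: "ratio = (\<lambda>y. ip xstar (xstar - y) / ip c (y - xstar))"
    and cstar: "cstar = (\<eta>star / 2) *\<^sub>R c + xstar"
  shows
    "\<eta>star = 2 * Max (ratio ` (V - M)) \<and>
     argmax_set ratio (V - M) = (V - M) \<inter> argmin_set (\<lambda>y. ip cstar y) P \<and>
     argmax_set ratio (V - M) \<noteq> {} \<and>
     (\<forall>t\<in>{\<eta> (n - 1)..\<eta>star}. x t \<in> argmin_set (\<lambda>y. ip cstar y) P) \<and>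
     (\<forall>t\<in>{\<eta> (n - 1)..<\<eta>star}. \<eta>star = 2 * (ip xstar (xstar - x t) / ip c (x t - xstar))) \<and>
     (\<forall>t\<in>{\<eta> (n - 1)..<\<eta>star}.
        E t / (\<eta>star - t)
          \<le> 1 / 2 * (ip c ((1 / ip_norm ip (xstar - x (\<eta> (n - 1)))) *\<^sub>R (xstar - x (\<eta> (n - 1)))))\<^sup>2 \<and>
        1 / 2 * (ip c ((1 / ip_norm ip (xstar - x (\<eta> (n - 1)))) *\<^sub>R (xstar - x (\<eta> (n - 1)))))\<^sup>2
          \<le> (ip_norm ip c)\<^sup>2 / 2)"
proof -

  \<comment> \<open>Optimality conditions for the curve and vertices outside
    \<open>M\<close>\<close>
  interpret inner_product_form ip by unfold_locales (rule ip)
  have P': "convex P" "compact P" "P \<noteq> {}"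
    using P polytope_imp_convex polytope_imp_compact by auto
  have M': "convex M" "compact M" "M \<noteq> {}"
    unfolding M using argmin_linear_convex_compact[OF P'] by auto
  have xs: "xstar \<in> M" "\<And>y. y \<in> M \<Longrightarrow> 0 \<le> ip xstar (y - xstar)"
    using the_argmin_norm_iff[OF M'] xstar by auto
  have M_eq: "M = {y \<in> P. ip c (y - xstar) = 0}"
    using argmin_linear_eq[of xstar c P] xs(1) M by simp
  have c_ge: "0 \<le> ip c (y - xstar)" if "y \<in> P" for y
    using xs(1) that by (auto simp: M argmin_set_def is_arg_min_linorder ip_simps)
  have c_pos: "0 < ip c (y - xstar)" if "y \<in> P" "y \<notin> M" for y
    using c_ge[of y] that M_eq by force
  have VI: "x t = z \<longleftrightarrow> z \<in> P \<and> (\<forall>y\<in>P. 0 \<le> ip ((t / 2) *\<^sub>R c + z) (y - z))" if "t \<ge> 0" for t z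
    using regularized_curve_iff[OF P' that] x by simp
  \<comment> \<open>The curve starts at the projection of the origin, so the hypothesis on the
    projection says that it starts outside \<open>M\<close>.\<close>
  have x0: "x 0 \<notin> M"
    using proj by (simp add: x regularized_curve_def projection_0_eq)
  have P_hull: "P = convex hull V"
    unfolding V using Krein_Milman_Minkowski P' by blast
  have VP: "V \<subseteq> P" by (auto simp: V extreme_point_of_def)
  have finV: "finite V"
    unfolding V using P(1) finite_polyhedron_extreme_points polytope_imp_polyhedron by blast
  \<comment> \<open>Makes the maximum of the ratios meaningful. Otherwise convexity of
    \<open>M\<close> would force all of \<open>P\<close>, including \<open>x 0\<close>, into
    \<open>M\<close>.\<close>
  have "V - M \<noteq> {}"
  proof
    assume "V - M = {}"
    then have "P \<subseteq> M" unfolding P_hull using M'(1) by (intro hull_minimal) auto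
    moreover have "x 0 \<in> P" using VI[of 0 "x 0"] by simp
    ultimately show False using x0 by blast
  qed
  \<comment> \<open>Since \<open>ip c (v - xstar)\<close> is positive here, the sign of the
    left-hand side only depends on how \<open>t / 2\<close> compares with
    \<open>ratio v\<close>.\<close>
  have ratio_factor: "ip ((t / 2) *\<^sub>R c + xstar) (v - xstar) = ip c (v - xstar) * (t / 2 - ratio v)"
    if "v \<in> V - M" for t v
  proof -
    have "ip c (v - xstar) * ratio v = - ip xstar (v - xstar)"
      using c_pos[of v] that VP by (auto simp: ratio ip_simps)
    then show ?thesis
      by (simp add: right_diff_distrib bilinear_ladd[OF bilinear] bilinear_lmul[OF bilinear])
  qed

  \<comment> \<open>The threshold as a maximum over vertices\<close>
  define R where "R = 2 * Max (ratio ` (V - M))"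
  have x_eq_iff: "x t = xstar \<longleftrightarrow> R \<le> t" if "t \<ge> 0" for t
  proof -
    have "x t = xstar \<longleftrightarrow> (\<forall>y\<in>P. 0 \<le> ip ((t / 2) *\<^sub>R c + xstar) (y - xstar))"
      using VI[OF that] xs(1) M_eq by auto
    also have "\<dots> \<longleftrightarrow> (\<forall>v\<in>V. 0 \<le> ip ((t / 2) *\<^sub>R c + xstar) (v - xstar))"
      using VP nonneg_on_convex_hull[of V _ xstar] unfolding P_hull by blast
    \<comment> \<open>At vertices in \<open>M\<close> the term with \<open>c\<close> vanishes, and
      the rest is nonnegative because \<open>xstar\<close> has minimal norm in
      \<open>M\<close>.\<close>
    also have "\<dots> \<longleftrightarrow> (\<forall>v\<in>V - M. 0 \<le> ip ((t / 2) *\<^sub>R c + xstar) (v - xstar))"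
    proof -
      have "0 \<le> ip ((t / 2) *\<^sub>R c + xstar) (v - xstar)" if "v \<in> M" for v
        using xs(2)[OF that] that M_eq
        by (simp add: bilinear_ladd[OF bilinear] bilinear_lmul[OF bilinear])
      then show ?thesis by blast
    qed
    also have "\<dots> \<longleftrightarrow> (\<forall>v\<in>V - M. ratio v \<le> t / 2)"
    proof (intro ball_cong refl)
      fix v assume v: "v \<in> V - M"
      then have "0 < ip c (v - xstar)" using c_pos VP by auto
      then show "0 \<le> ip ((t / 2) *\<^sub>R c + xstar) (v - xstar) \<longleftrightarrow> ratio v \<le> t / 2"
        unfolding ratio_factor[OF v] by (simp add: zero_le_mult_iff)
    qed
    also have "\<dots> \<longleftrightarrow> Max (ratio ` (V - M)) \<le> t / 2"
      using finV \<open>V - M \<noteq> {}\<close> by (subst Max_le_iff) auto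
    finally show ?thesis by (simp add: R_def mult.commute)
  qed
  have "R > 0" using x_eq_iff[of 0] x0 xs(1) by fastforce
  have bp: "1 \<le> n" "\<eta> 0 = 0" "\<And>i. i < n \<Longrightarrow> \<eta> i < \<eta> (Suc i)"
    "\<And>i. i < n \<Longrightarrow> affine_map_on {\<eta> i..\<eta> (Suc i)} x"
    "\<And>t. t \<ge> \<eta>star \<Longrightarrow> x t = xstar"
    "\<And>s. s \<ge> 0 \<Longrightarrow> (\<forall>t\<ge>s. x t = xstar) \<Longrightarrow> \<eta>star \<le> s"
    using breakpoints unfolding is_breakpoints_def \<eta>star by blast+
  have \<eta>_nonneg: "i \<le> n \<Longrightarrow> 0 \<le> \<eta> i" for i
  proof (induction i)
    case (Suc i)
    then show ?case using bp(3)[of i] by simp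
  qed (simp add: bp(2))
  \<comment> \<open>\<open>R \<le> \<eta>star\<close> because the curve is at \<open>xstar\<close>
    at time \<open>\<eta>star\<close>; the converse is minimality of \<open>\<eta>star\<close>,
    applied to the admissible threshold \<open>R > 0\<close>.\<close>
  have \<eta>star_eq: "\<eta>star = R"
    using bp(5)[of \<eta>star] bp(6)[of R] x_eq_iff \<eta>_nonneg[of n] \<open>R > 0\<close> \<eta>star by fastforce
  have "\<eta>star > 0" using \<open>R > 0\<close> \<eta>star_eq by simp

  \<comment> \<open>The auxiliary cost and the maximizing vertices\<close>
  have cstar_ge: "0 \<le> ip cstar (y - xstar)" if "y \<in> P" for y
    \<comment> \<open>\<open>cstar\<close> is exactly the vector in the variational inequality at
      \<open>t = \<eta>star\<close>, where the curve sits at \<open>xstar\<close>.\<close>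
    using VI[of \<eta>star xstar] bp(5)[of \<eta>star] \<open>\<eta>star > 0\<close> that by (simp add: cstar)
  have xs_P: "xstar \<in> P" using xs(1) M_eq by simp
  have "xstar \<in> argmin_set (ip cstar) P"
    using cstar_ge xs_P by (auto simp: argmin_set_def is_arg_min_linorder ip_simps)
  then have argmin_cstar: "argmin_set (ip cstar) P = {y \<in> P. ip cstar (y - xstar) = 0}"
    by (rule argmin_linear_eq)

  have Max_in_ratio: "Max (ratio ` (V - M)) \<in> ratio ` (V - M)"
    using finV \<open>V - M \<noteq> {}\<close> by (intro Max_in) auto
  have argmax_ratio: "argmax_set ratio (V - M) = {v \<in> V - M. ratio v = \<eta>star / 2}"
  proof -
    have "Max (ratio ` (V - M)) = \<eta>star / 2" by (simp add: \<eta>star_eq R_def)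
    moreover have "ratio v \<le> Max (ratio ` (V - M))" if "v \<in> V - M" for v
      using finV that by simp
    ultimately show ?thesis
      using Max_in_ratio by (fastforce simp: argmax_set_def is_arg_max_linorder)
  qed
  have argmax_nonempty: "argmax_set ratio (V - M) \<noteq> {}"
    using Max_in_ratio unfolding argmax_ratio by (auto simp: \<eta>star_eq R_def)
  have argmax_eq: "argmax_set ratio (V - M) = (V - M) \<inter> argmin_set (ip cstar) P"
  proof -
    \<comment> \<open>At \<open>t = \<eta>star\<close> the left-hand side of
      \<open>ratio_factor\<close> is \<open>ip cstar (v - xstar)\<close>, which vanishes only
      through the factor \<open>\<eta>star / 2 - ratio v\<close>.\<close>
    have "ratio v = \<eta>star / 2 \<longleftrightarrow> ip cstar (v - xstar) = 0" if "v \<in> V - M" for v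
      using ratio_factor[OF that, of \<eta>star] c_pos[of v] that VP by (auto simp: cstar)
    then show ?thesis unfolding argmax_ratio argmin_cstar using VP by auto
  qed

  \<comment> \<open>The last segment of the curve\<close>
  define t0 where "t0 = \<eta> (n - 1)"
  have t0: "0 \<le> t0" "t0 < \<eta>star"
    using \<eta>_nonneg[of "n - 1"] bp(1) bp(3)[of "n - 1"] by (simp_all add: t0_def \<eta>star)
  have "affine_map_on {t0..\<eta>star} x"
    using bp(4)[of "n - 1"] bp(1) by (simp add: t0_def \<eta>star)
  then obtain u v where uv: "\<And>t. t \<in> {t0..\<eta>star} \<Longrightarrow> x t = u + t *\<^sub>R v"
    unfolding affine_map_on_def by blast
  \<comment> \<open>\<open>w\<close> points backwards along the segment, away from
    \<open>xstar\<close>, so that \<open>s = \<eta>star - t\<close> is the natural nonnegative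
    parameter.\<close>
  define w where "w = - v"
  have "u + \<eta>star *\<^sub>R v = xstar" using uv[of \<eta>star] bp(5)[of \<eta>star] t0 by simp
  then have seg: "x t = xstar + (\<eta>star - t) *\<^sub>R w" if "t \<in> {t0..\<eta>star}" for t
    using uv[OF that] by (auto simp: w_def algebra_simps)
  have x_P: "x t \<in> P" if "t \<ge> 0" for t using VI[OF that, of "x t"] by simp

  have "0 \<le> ip cstar ((\<eta>star - t0) *\<^sub>R w)"
    using cstar_ge[OF x_P[OF t0(1)]] seg[of t0] t0 by simp
  then have "0 \<le> ip cstar w" using t0 by (simp add: ip_simps zero_le_mult_iff)
  have key: "0 \<le> - ip cstar w + s * (ip c w / 2 - ip w w)" if s: "0 < s" "s \<le> \<eta>star - t0" for s
  proof -
    have t: "\<eta>star - s \<in> {t0..\<eta>star}" "0 \<le> \<eta>star - s" using s t0 by auto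
    have "0 \<le> ip (((\<eta>star - s) / 2) *\<^sub>R c + x (\<eta>star - s)) (xstar - x (\<eta>star - s))"
      using VI[OF t(2), of "x (\<eta>star - s)"] xs_P by blast
    \<comment> \<open>The test direction is \<open>- s *\<^sub>R w\<close>; its factor
      \<open>s\<close> is divided out so that the term of order zero survives in the limit.\<close>
    also have "\<dots> = s * (- ip cstar w + s * (ip c w / 2 - ip w w))"
      unfolding seg[OF t(1)] cstar by (simp add: ip_simps algebra_simps diff_divide_distrib)
    finally show ?thesis using s by (simp add: zero_le_mult_iff)
  qed
  have "0 \<le> - ip cstar w"
  proof (rule nonneg_if_affine_nonneg_near_0)
    show "0 < \<eta>star - t0" using t0 by simp
  qed (rule key)
  with \<open>0 \<le> ip cstar w\<close> have cstar_w: "ip cstar w = 0" by simp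
  \<comment> \<open>With the constant term of \<open>key\<close> gone, a single \<open>s > 0\<close>
    determines the sign of the coefficient of \<open>s\<close>; the full length of the segment is
    used.\<close>
  have w_le: "2 * ip w w \<le> ip c w"
    using key[of "\<eta>star - t0"] t0 cstar_w by (simp add: zero_le_mult_iff)
  have "w \<noteq> 0"
  proof
    assume "w = 0"
    then have "x t0 = xstar" using seg[of t0] t0 by simp
    then show False using x_eq_iff[OF t0(1)] \<eta>star_eq t0 by simp
  qed
  then have "0 < ip w w" by (rule pos)
  with w_le have "0 < ip c w" by linarith

  have seg_argmin: "\<forall>t\<in>{t0..\<eta>star}. x t \<in> argmin_set (ip cstar) P"
  proof
    fix t assume t: "t \<in> {t0..\<eta>star}"
    then have "x t \<in> P" using t0 by (intro x_P) simp
    then show "x t \<in> argmin_set (ip cstar) P"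
      unfolding argmin_cstar using seg[OF t] cstar_w by (simp add: ip_simps)
  qed
  \<comment> \<open>This is \<open>ip cstar w = 0\<close> solved for \<open>\<eta>star\<close>. The
    common factor \<open>\<eta>star - t\<close> cancels from the quotient, which requires
    \<open>t < \<eta>star\<close>.\<close>
  have seg_ratio: "\<eta>star = 2 * (ip xstar (xstar - x t) / ip c (x t - xstar))"
    if t: "t \<in> {t0..<\<eta>star}" for t
  proof -
    have "\<eta>star / 2 * ip c w = - ip xstar w"
      using cstar_w by (simp add: cstar ip_simps)
    then have "\<eta>star = 2 * (- ip xstar w / ip c w)"
      using \<open>0 < ip c w\<close> by (simp add: field_simps)
    moreover have "ip xstar (xstar - x t) / ip c (x t - xstar) = - ip xstar w / ip c w"
      using seg[of t] t by (simp add: ip_simps)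
    ultimately show ?thesis by simp
  qed
  have E_slope: "E t / (\<eta>star - t) = ip c w" if t: "t \<in> {t0..<\<eta>star}" for t
  proof -
    have "(INF y\<in>P. ip c y) = ip c xstar"
      using xs_P c_ge by (intro cInf_eq_minimum) (auto simp: ip_simps)
    then show ?thesis using seg[of t] t by (simp add: E ip_simps)
  qed

  \<comment> \<open>The bound on the slope\<close>
  define e where "e = (1 / ip_norm ip (xstar - x t0)) *\<^sub>R (xstar - x t0)"
  have "xstar - x t0 = - ((\<eta>star - t0) *\<^sub>R w)" using seg[of t0] t0 by simp
  then have d: "xstar - x t0 = (t0 - \<eta>star) *\<^sub>R w" by (simp add: algebra_simps)
  have "ip (xstar - x t0) (xstar - x t0) = (t0 - \<eta>star)\<^sup>2 * ip w w"
    unfolding d by (simp add: ip_simps power2_eq_square)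
  then have norm_d: "(ip_norm ip (xstar - x t0))\<^sup>2 = (t0 - \<eta>star)\<^sup>2 * ip w w"
    by (simp add: ip_norm_power2)
  have "ip e e = ip (xstar - x t0) (xstar - x t0) / (ip_norm ip (xstar - x t0))\<^sup>2"
    by (simp add: e_def bilinear_lmul[OF bilinear] bilinear_rmul[OF bilinear] power2_eq_square)
  \<comment> \<open>The inequality form is safe for a zero denominator, where division yields
    0.\<close>
  then have e_unit: "ip e e \<le> 1" by (simp add: ip_norm_power2)
  have "(ip c e)\<^sup>2 = (ip c (xstar - x t0))\<^sup>2 / (ip_norm ip (xstar - x t0))\<^sup>2"
    by (simp add: e_def bilinear_rmul[OF bilinear] power_divide)
  also have "\<dots> = (ip c w)\<^sup>2 / ip w w"
    unfolding norm_d using t0 by (simp add: d ip_simps power_mult_distrib)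
  finally have c_e: "(ip c e)\<^sup>2 = (ip c w)\<^sup>2 / ip w w" .
  \<comment> \<open>Dividing by \<open>2 * ip w w\<close> bounds the slope \<open>ip c w\<close> by
    half of \<open>(ip c w)\<^sup>2 / ip w w\<close>, which is \<open>(ip c e)\<^sup>2\<close>; the
    opposite orientation of \<open>e\<close> and \<open>w\<close> disappears in the square.\<close>
  have "ip c w * (2 * ip w w) \<le> ip c w * ip c w"
    using w_le \<open>0 < ip c w\<close> by (intro mult_left_mono) auto
  then have bound1: "ip c w \<le> 1 / 2 * (ip c e)\<^sup>2"
    unfolding c_e using \<open>0 < ip w w\<close> by (simp add: field_simps power2_eq_square)
  have "(ip c e)\<^sup>2 \<le> ip c c * ip e e" by (rule Cauchy_Schwarz)
  also have "\<dots> \<le> ip c c" using e_unit ip_ge_0 by (simp add: mult_left_le)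
  finally have bound2: "1 / 2 * (ip c e)\<^sup>2 \<le> (ip_norm ip c)\<^sup>2 / 2"
    by (simp add: ip_norm_power2)

  show ?thesis
    unfolding t0_def[symmetric] e_def[symmetric]
    using \<eta>star_eq[unfolded R_def] argmax_eq argmax_nonempty seg_argmin seg_ratio E_slope
      bound1 bound2
    by simp
qed

end
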